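(* There exists a universal constant $c>0$ such that for every $p>1$ and every non-constant $p$-knowable Boolean function $f$, writing $\nu=\mathbb E[\max W(f)]$, $$\sup_kI_k(f)\ge c\,\mathrm{Var}(f)\frac{\log\nu}{\nu}-\frac1{p-1}\,\frac{\mathbb E[(\max W(f))^p]}{\nu^p}.$$
   Context: Let $\Omega=\{-1,1\}$ and $\Omega^\infty=\{-1,1\}^{\mathbb N}$ with the uniform product probability measure; $\omega$ denotes a uniformly random element. A Boolean function is a measurable map $f:\Omega^\infty\to\Omega$. $\omega^{(k)}$ is $\omega$ with bit $k$ flipped; $I_k(f)=\mathbb P(f(\omega^{(k)})\ne f(\omega))$. A set $W\subseteq\mathbb N$ is a witness set for $f$ at $\omega$ if there is an event $A$ with $\mathbb P(A)=1$ such that for all $\tilde\omega\in A$: if $\tilde\omega_i=\omega_i$ for all $i\in W$ then $f(\tilde\omega)=f(\omega)$. $f$ is finitary if almost surely a finite witness set exists; then $W(f)(\omega)$ denotes the least finite witness set in the order: smaller maximum first, then smaller cardinality, then lexicographic. $f$ is $p$-knowable if it is finitary and $\mathbb E[(\max W(f))^p]<\infty$. $\log$ is the natural logarithm. *)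

theory Defs
  imports "HOL-Probability.Probability"
begin

text \<open>Omega = {-1,1} is encoded as bool (True ~ 1, False ~ -1).
  Omega^infty = nat => bool with the uniform product measure.
  Coordinate i (0-based) represents bit i+1 of the paper (N = {1,2,...}).\<close>

definition Cube :: "(nat \<Rightarrow> bool) measure" where
  "Cube = PiM UNIV (\<lambda>_. measure_pmf (bernoulli_pmf (1/2)))"

definition sgnb :: "bool \<Rightarrow> real" where
  "sgnb b = (if b then 1 else -1)"

definition flip_bit :: "nat \<Rightarrow> (nat \<Rightarrow> bool) \<Rightarrow> (nat \<Rightarrow> bool)" where
  "flip_bit k \<omega> = fun_upd \<omega> k (\<not> \<omega> k)"

definition boolean_function :: "((nat \<Rightarrow> bool) \<Rightarrow> bool) \<Rightarrow> bool" where
  "boolean_function f \<longleftrightarrow> f \<in> measurable Cube (count_space UNIV)"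

definition influence :: "((nat \<Rightarrow> bool) \<Rightarrow> bool) \<Rightarrow> nat \<Rightarrow> real" where
  "influence f k = measure Cube {\<omega> \<in> space Cube. f (flip_bit k \<omega>) \<noteq> f \<omega>}"

definition Var_bf :: "((nat \<Rightarrow> bool) \<Rightarrow> bool) \<Rightarrow> real" where
  "Var_bf f = (\<integral>\<omega>. (sgnb (f \<omega>) - (\<integral>\<eta>. sgnb (f \<eta>) \<partial>Cube))\<^sup>2 \<partial>Cube)"

definition nonconstant :: "((nat \<Rightarrow> bool) \<Rightarrow> bool) \<Rightarrow> bool" where
  "nonconstant f \<longleftrightarrow> \<not> (\<exists>b. AE \<omega> in Cube. f \<omega> = b)"

definition witness :: "((nat \<Rightarrow> bool) \<Rightarrow> bool) \<Rightarrow> (nat \<Rightarrow> bool) \<Rightarrow> nat set \<Rightarrow> bool" where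
  "witness f \<omega> W \<longleftrightarrow>
     (\<exists>A \<in> sets Cube. prob_space.prob Cube A = 1 \<and>
        (\<forall>\<eta> \<in> A. (\<forall>i \<in> W. \<eta> i = \<omega> i) \<longrightarrow> f \<eta> = f \<omega>))"

definition finitary :: "((nat \<Rightarrow> bool) \<Rightarrow> bool) \<Rightarrow> bool" where
  "finitary f \<longleftrightarrow> (AE \<omega> in Cube. \<exists>W. finite W \<and> witness f \<omega> W)"

text \<open>max W(f)(omega), in the paper's 1-based indexing: since the order on finite
  witness sets compares the maximum first, the maximum of the least witness set
  is the least possible maximum of a finite witness set. With 0-based coordinates,
  a set W has 1-based maximum < n+1 iff all its elements are < n.\<close>
definition maxW :: "((nat \<Rightarrow> bool) \<Rightarrow> bool) \<Rightarrow> (nat \<Rightarrow> bool) \<Rightarrow> nat" where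
  "maxW f \<omega> = (LEAST n. \<exists>W. finite W \<and> witness f \<omega> W \<and> (\<forall>i \<in> W. i < n))"

definition knowable :: "real \<Rightarrow> ((nat \<Rightarrow> bool) \<Rightarrow> bool) \<Rightarrow> bool" where
  "knowable p f \<longleftrightarrow> finitary f \<and>
     (\<integral>\<^sup>+ \<omega>. ennreal (real (maxW f \<omega>) powr p) \<partial>Cube) < \<infinity>"

end

theory Submission
  imports Defs
begin

text \<open>
  The argument follows Falik and Samorodnitsky. On a finite cube, split \<open>g - E g\<close> into martingale
  differences \<open>d\<^sub>j\<close>, obtained by averaging out one bit at a time. The logarithmic Sobolev inequality
  bounds the sum of the entropies of the \<open>d\<^sub>j\<^sup>2\<close> from above by the total influence, while
  \<open>Ent (d\<^sup>2) \<ge> (L + 1) E d\<^sup>2 - exp L (E \<bar>d\<bar>)\<^sup>2\<close> for every \<open>L\<close>. Hence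
  \<open>(L + 1) Var g \<le> 4 \<Sum> I\<^sub>k + exp L \<Sum> I\<^sub>k\<^sup>2\<close>, an inequality linear in the variance, which passes to the
  infinite cube by averaging \<open>f\<close> over cylinders: around almost every point, the cylinder
  of length \<open>max W\<close> already determines \<open>f\<close>.

  Let \<open>\<delta> = sup I\<^sub>k\<close>. If \<open>\<delta> > \<nu>\<^sup>-\<^sup>1\<^sup>/\<^sup>2\<close> there is nothing to prove. Otherwise \<open>L = (ln \<nu>) / 4\<close> gives
  \<open>\<Sum> I\<^sub>k \<ge> Var f ln \<nu> / 20\<close>. On the other hand \<open>I\<^sub>k \<le> P (max W \<ge> k)\<close>, so
  \<open>\<Sum> I\<^sub>k \<le> 2 \<nu> \<delta> + E (max W - \<nu>)\<^sup>+\<close>, and \<open>x - 1 \<le> x\<^sup>p / (p - 1)\<close> for \<open>x \<ge> 1\<close> bounds the last term.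
\<close>

section \<open>Averages and differences on finite cubes\<close>

definition coord_mean :: "nat \<Rightarrow> ((nat \<Rightarrow> bool) \<Rightarrow> real) \<Rightarrow> (nat \<Rightarrow> bool) \<Rightarrow> real" where
  "coord_mean k g w = (g (w(k := True)) + g (w(k := False))) / 2"

definition coord_diff :: "nat \<Rightarrow> ((nat \<Rightarrow> bool) \<Rightarrow> real) \<Rightarrow> (nat \<Rightarrow> bool) \<Rightarrow> real" where
  "coord_diff k g w = (g (w(k := True)) - g (w(k := False))) / 2"

text \<open>This is the conditional expectation given the bits from \<open>n\<close> on. It stays a
  function on all sequences, so finite cubes of every dimension share one type and the induction on
  \<open>n\<close> can treat bit \<open>n\<close> as a parameter.\<close>

primrec cube_mean :: "nat \<Rightarrow> ((nat \<Rightarrow> bool) \<Rightarrow> real) \<Rightarrow> (nat \<Rightarrow> bool) \<Rightarrow> real" where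
  "cube_mean 0 g = g"
| "cube_mean (Suc n) g = coord_mean n (cube_mean n g)"

lemma coord_mean_commute: "coord_mean j (coord_mean k g) = coord_mean k (coord_mean j g)"
proof (cases "j = k")
  case False
  then show ?thesis by (simp add: coord_mean_def fun_upd_twist[OF False] fun_eq_iff field_simps)
qed simp

lemma coord_diff_mean_commute:
  assumes "j \<noteq> k"
  shows "coord_diff j (coord_mean k g) = coord_mean k (coord_diff j g)"
  by (simp add: coord_mean_def coord_diff_def fun_upd_twist[OF assms] fun_eq_iff field_simps)

lemma coord_diff_commute: "coord_diff j (coord_diff k g) = coord_diff k (coord_diff j g)"
proof (cases "j = k")
  case False
  then show ?thesis by (simp add: coord_diff_def fun_upd_twist[OF False] fun_eq_iff field_simps)
qed simp

lemma coord_mean_cube_mean: "coord_mean k (cube_mean n g) = cube_mean n (coord_mean k g)"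
proof (induction n)
  case (Suc n)
  then show ?case by (simp add: coord_mean_commute[of k n])
qed simp

lemma cube_mean_upd: "n \<le> k \<Longrightarrow> cube_mean n g (w(k := b)) = cube_mean n (\<lambda>w. g (w(k := b))) w"
proof (induct n arbitrary: w)
  case (Suc n)
  then have "k \<noteq> n" by auto
  then have "w(k := b, n := c) = w(n := c, k := b)" for c by (simp only: fun_upd_twist)
  with Suc show ?case by (simp only: cube_mean.simps coord_mean_def Suc_leD)
qed simp

lemma cube_mean_upd_less: "k < n \<Longrightarrow> cube_mean n g (w(k := b)) = cube_mean n g w"
proof (induct n arbitrary: w)
  case (Suc n)
  show ?case
  proof (cases "k = n")
    case True
    then show ?thesis by (simp only: cube_mean.simps coord_mean_def fun_upd_upd)
  next
    case False
    with Suc(2) have "k < n" by simp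
    from False have "w(k := b, n := c) = w(n := c, k := b)" for c by (simp only: fun_upd_twist)
    then show ?thesis by (simp only: cube_mean.simps coord_mean_def Suc(1)[OF \<open>k < n\<close>])
  qed
qed simp

lemma cube_mean_const [simp]: "cube_mean n (\<lambda>_. c) w = c"
  by (induction n arbitrary: w) (simp_all add: coord_mean_def)

lemma cube_mean_add: "cube_mean n (\<lambda>w. f w + g w) w = cube_mean n f w + cube_mean n g w"
  by (induction n arbitrary: w) (simp_all add: coord_mean_def field_simps)

lemma cube_mean_cmult: "cube_mean n (\<lambda>w. c * g w) w = c * cube_mean n g w"
  by (induction n arbitrary: w) (simp_all add: coord_mean_def field_simps)

lemma cube_mean_diff: "cube_mean n (\<lambda>w. f w - g w) w = cube_mean n f w - cube_mean n g w"
  by (induction n arbitrary: w) (simp_all add: coord_mean_def diff_divide_distrib add_divide_distrib)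

lemma cube_mean_mono: "(\<And>w. f w \<le> g w) \<Longrightarrow> cube_mean n f w \<le> cube_mean n g w"
  by (induction n arbitrary: w) (simp_all add: coord_mean_def add_mono)

lemma cube_mean_nonneg: "(\<And>w. 0 \<le> g w) \<Longrightarrow> 0 \<le> cube_mean n g w"
  using cube_mean_mono[of "\<lambda>_. 0" g n w] by simp

lemma abs_cube_mean_le: "\<bar>cube_mean n g w\<bar> \<le> cube_mean n (\<lambda>w. \<bar>g w\<bar>) w"
proof -
  have "cube_mean n g w \<le> cube_mean n (\<lambda>w. \<bar>g w\<bar>) w"
    by (rule cube_mean_mono) simp
  moreover have "cube_mean n (\<lambda>w. - 1 * g w) w \<le> cube_mean n (\<lambda>w. \<bar>g w\<bar>) w"
    by (rule cube_mean_mono) simp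
  then have "- cube_mean n g w \<le> cube_mean n (\<lambda>w. \<bar>g w\<bar>) w"
    by (subst (asm) cube_mean_cmult) simp
  ultimately show ?thesis by simp
qed

lemma coord_diff_cube_mean:
  "n \<le> k \<Longrightarrow> coord_diff k (cube_mean n g) = cube_mean n (coord_diff k g)"
proof (induction n)
  case (Suc n)
  then show ?case by (simp add: coord_diff_mean_commute)
qed simp

lemma coord_diff_cube_mean_eq_0: "k < n \<Longrightarrow> coord_diff k (cube_mean n g) w = 0"
  by (simp add: coord_diff_def cube_mean_upd_less)

lemma cube_mean_cube_mean: "j \<le> n \<Longrightarrow> cube_mean n (cube_mean j g) = cube_mean n g"
proof (induction n)
  case (Suc n)
  show ?case
  proof (cases "j = Suc n")
    case True
    \<comment> \<open>The induction hypothesis covers only \<open>j \<le> n\<close>; the remaining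
      case is idempotence, which holds since the inner average no longer depends on the bits being
      averaged.\<close>
    have "cube_mean m (cube_mean m g) = cube_mean m g" for m
    proof (rule ext)
      fix w
      have gen: "cube_mean i h w = h w" if "i \<le> m" "\<And>k b w. k < m \<Longrightarrow> h (w(k := b)) = h w" for h i w
        using that by (induction i arbitrary: w) (simp_all add: coord_mean_def)
      show "cube_mean m (cube_mean m g) w = cube_mean m g w"
        by (rule gen) (simp_all add: cube_mean_upd_less)
    qed
    then show ?thesis using True by blast
  next
    case False
    with Suc show ?thesis by simp
  qed
qed simp

text \<open>Expand the mean of \<open>(u - s * v)\<^sup>2\<close> at \<open>s = c / K\<close>.
  Allowing any positive upper bound \<open>K\<close> for the second moment of \<open>v\<close>
  avoids a separate treatment of a vanishing moment.\<close>

lemma cube_mean_cauchy_schwarz: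
  assumes "cube_mean n (\<lambda>w. (v w)\<^sup>2) w \<le> K" "0 < K"
  shows "(cube_mean n (\<lambda>w. u w * v w) w)\<^sup>2 \<le> cube_mean n (\<lambda>w. (u w)\<^sup>2) w * K"
proof -
  define c where "c = cube_mean n (\<lambda>w. u w * v w) w"
  define s where "s = c / K"
  have "0 \<le> cube_mean n (\<lambda>w. (u w - s * v w)\<^sup>2) w"
    by (rule cube_mean_nonneg) simp
  also have "(\<lambda>w. (u w - s * v w)\<^sup>2)
      = (\<lambda>w. (u w)\<^sup>2 + ((- 2 * s) * (u w * v w) + s\<^sup>2 * (v w)\<^sup>2))"
    by (auto simp: power2_eq_square algebra_simps)
  also have "cube_mean n \<dots> w
      = cube_mean n (\<lambda>w. (u w)\<^sup>2) w + ((- 2 * s) * c + s\<^sup>2 * cube_mean n (\<lambda>w. (v w)\<^sup>2) w)"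
    by (simp only: cube_mean_add cube_mean_cmult c_def)
  also have "\<dots> \<le> cube_mean n (\<lambda>w. (u w)\<^sup>2) w + ((- 2 * s) * c + s\<^sup>2 * K)"
    using assms(1) by (simp add: mult_left_mono)
  also have "(- 2 * s) * c + s\<^sup>2 * K = - (c\<^sup>2 / K)"
    using \<open>0 < K\<close> by (simp add: s_def power2_eq_square field_simps)
  finally have "c\<^sup>2 / K \<le> cube_mean n (\<lambda>w. (u w)\<^sup>2) w" by simp
  then show ?thesis using \<open>0 < K\<close> by (simp add: c_def field_simps)
qed

section \<open>Entropy and the logarithmic Sobolev inequality\<close>

lemma mult_ln_ratio_le:
  fixes x \<mu> :: real
  assumes "0 \<le> x" "0 < \<mu>"
  shows "x * ln x \<le> x * ln \<mu> + x * (x / \<mu> - 1)"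
proof (cases "x = 0")
  case False
  with assms have "ln (x / \<mu>) \<le> x / \<mu> - 1" by (intro ln_le_minus_one) simp
  with assms False have "ln x \<le> ln \<mu> + (x / \<mu> - 1)" by (simp add: ln_div)
  with assms show ?thesis by (metis distrib_left mult_left_mono)
qed simp

text \<open>Entropy is at most variance over mean: apply \<open>ln t \<le> t - 1\<close> to the
  ratios of \<open>x\<close> and \<open>y\<close> to their mean; the terms with the logarithm of the
  mean cancel.\<close>

lemma two_point_entropy_le:
  fixes x y :: real
  assumes "0 \<le> x" "0 \<le> y" "0 < x + y"
  shows "(x * ln x + y * ln y) / 2 - (x + y) / 2 * ln ((x + y) / 2) \<le> (x - y)\<^sup>2 / (2 * (x + y))"
proof -
  define \<mu> where "\<mu> = (x + y) / 2"
  have \<mu>: "0 < \<mu>" using assms by (simp add: \<mu>_def)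
  have "(x * ln x + y * ln y) / 2 - \<mu> * ln \<mu>
      \<le> ((x * ln \<mu> + x * (x / \<mu> - 1)) + (y * ln \<mu> + y * (y / \<mu> - 1))) / 2 - \<mu> * ln \<mu>"
    by (intro diff_right_mono divide_right_mono add_mono mult_ln_ratio_le assms \<mu>) simp
  also have "\<dots> = (x * (x / \<mu> - 1) + y * (y / \<mu> - 1)) / 2"
  proof -
    have "((x * l + X) + (y * l + Y)) / 2 - \<mu> * l = (X + Y) / 2" for l X Y
      by (simp add: \<mu>_def field_simps)
    then show ?thesis .
  qed
  also have "\<dots> = (x - y)\<^sup>2 / (2 * (x + y))"
  proof -
    have y: "y = 2 * \<mu> - x" unfolding \<mu>_def by argo
    show ?thesis unfolding y using \<mu> by (simp add: field_simps power2_eq_square)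
  qed
  finally show ?thesis by (simp add: \<mu>_def)
qed

text \<open>Induction on the dimension by the chain rule: the entropy over \<open>Suc n\<close> bits
  is the average of the entropies over \<open>n\<close> bits plus the two-point entropy of the
  conditional second moments \<open>x\<close> and \<open>y\<close>. Bounding the latter by variance
  over mean costs a constant factor, which a universal constant absorbs.\<close>

lemma cube_log_sobolev:
  "cube_mean n (\<lambda>w. (h w)\<^sup>2 * ln ((h w)\<^sup>2)) w
     - cube_mean n (\<lambda>w. (h w)\<^sup>2) w * ln (cube_mean n (\<lambda>w. (h w)\<^sup>2) w)
   \<le> 4 * (\<Sum>i<n. cube_mean n (\<lambda>w. (coord_diff i h w)\<^sup>2) w)"
proof (induction n arbitrary: w)
  case (Suc n)
  define P where "P = cube_mean n (\<lambda>w. (h w)\<^sup>2 * ln ((h w)\<^sup>2))"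
  define m where "m = cube_mean n (\<lambda>w. (h w)\<^sup>2)"
  define S where "S = (\<lambda>w. \<Sum>i<n. cube_mean n (\<lambda>w. (coord_diff i h w)\<^sup>2) w)"
  define x where "x = m (w(n := True))"
  define y where "y = m (w(n := False))"
  define T where "T = cube_mean n (\<lambda>w. (coord_diff n h w)\<^sup>2) w"
  have IH: "P w' - m w' * ln (m w') \<le> 4 * S w'" for w'
    using Suc by (simp add: P_def m_def S_def)
  have xy: "0 \<le> x" "0 \<le> y" by (auto simp: x_def y_def m_def intro!: cube_mean_nonneg)
  let ?u = "\<lambda>w. h (w(n := True))" and ?v = "\<lambda>w. h (w(n := False))"
  have x_eq: "x = cube_mean n (\<lambda>w. (?u w)\<^sup>2) w" and y_eq: "y = cube_mean n (\<lambda>w. (?v w)\<^sup>2) w"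
    by (simp_all add: x_def y_def m_def cube_mean_upd)
  have T_eq: "4 * T = cube_mean n (\<lambda>w. (?u w - ?v w)\<^sup>2) w"
    unfolding T_def cube_mean_cmult[symmetric] by (simp add: coord_diff_def power2_eq_square)
  \<comment> \<open>Since \<open>x - y\<close> is the mean of \<open>(?u - ?v) * (?u + ?v)\<close>,
    Cauchy-Schwarz bounds its square by \<open>4 * T\<close> times the mean of
    \<open>(?u + ?v)\<^sup>2\<close>. That mean is at most \<open>2 * (x + y)\<close>, which cancels
    the denominator in the two-point bound.\<close>
  have gap: "(x * ln x + y * ln y) / 2 - (x + y) / 2 * ln ((x + y) / 2) \<le> 4 * T"
  proof (cases "x + y = 0")
    case True
    with xy have "x = 0" "y = 0" by auto
    moreover have "0 \<le> T" unfolding T_def by (rule cube_mean_nonneg) simp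
    ultimately show ?thesis by simp
  next
    case False
    with xy have pos: "0 < x + y" by simp
    have "cube_mean n (\<lambda>w. (?u w + ?v w)\<^sup>2) w \<le> cube_mean n (\<lambda>w. 2 * ((?u w)\<^sup>2 + (?v w)\<^sup>2)) w"
      by (rule cube_mean_mono) (smt (verit) power2_sum sum_squares_bound)
    also have "\<dots> = 2 * (x + y)"
      by (simp only: cube_mean_cmult cube_mean_add x_eq y_eq)
    finally have "(cube_mean n (\<lambda>w. (?u w - ?v w) * (?u w + ?v w)) w)\<^sup>2 \<le> 4 * T * (2 * (x + y))"
      unfolding T_eq by (rule cube_mean_cauchy_schwarz) (use pos in simp)
    also have "(\<lambda>w. (?u w - ?v w) * (?u w + ?v w)) = (\<lambda>w. (?u w)\<^sup>2 - (?v w)\<^sup>2)"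
      by (auto simp: power2_eq_square algebra_simps)
    also have "cube_mean n \<dots> w = x - y"
      by (simp only: cube_mean_diff x_eq y_eq)
    finally have "(x - y)\<^sup>2 / (2 * (x + y)) \<le> 4 * T"
      using pos by (simp add: field_simps)
    with two_point_entropy_le[OF xy pos] show ?thesis by linarith
  qed
  have "coord_mean n P w - (x * ln x + y * ln y) / 2 \<le> 4 * coord_mean n S w"
    using IH[of "w(n := True)"] IH[of "w(n := False)"]
    by (simp add: coord_mean_def x_def y_def field_simps)
  moreover have "coord_mean n S w = (\<Sum>i<n. cube_mean (Suc n) (\<lambda>w. (coord_diff i h w)\<^sup>2) w)"
    by (simp add: S_def coord_mean_def sum.distrib sum_divide_distrib[symmetric])
  moreover have "T = cube_mean (Suc n) (\<lambda>w. (coord_diff n h w)\<^sup>2) w"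
    by (simp add: T_def coord_mean_def cube_mean_upd coord_diff_def)
  moreover have m_eq: "coord_mean n m w = (x + y) / 2"
    by (simp add: coord_mean_def x_def y_def)
  ultimately show ?case
    using gap unfolding sum.lessThan_Suc cube_mean.simps P_def[symmetric] m_def[symmetric] m_eq
    by argo
qed simp

section \<open>Martingale differences and the Falik-Samorodnitsky inequality\<close>

text \<open>Up to the sign given by bit \<open>j\<close>,
  \<open>cube_mean j (coord_diff j g)\<close> is the martingale difference
  \<open>cube_mean j g - cube_mean (Suc j) g\<close>, so this is Pythagoras for martingale
  differences. Dropping the sign leaves squares unchanged and removes the dependence on bit
  \<open>j\<close>.\<close>

lemma cube_variance_decomposition:
  "cube_mean n (\<lambda>w. (g w)\<^sup>2) w - (cube_mean n g w)\<^sup>2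
   = (\<Sum>j<n. cube_mean n (\<lambda>w. (cube_mean j (coord_diff j g) w)\<^sup>2) w)"
proof (induction n arbitrary: w)
  case (Suc n)
  define u where "u = (\<lambda>j. cube_mean j (coord_diff j g))"
  \<comment> \<open>The bits below \<open>n\<close> are averaged out in \<open>u n\<close> and bit
    \<open>n\<close> is differenced out, so averaging over all of them changes nothing.\<close>
  have "cube_mean (Suc n) (\<lambda>w. (u n w)\<^sup>2) w = (u n w)\<^sup>2"
  proof -
    have "u n (w(k := b)) = u n w" if "k \<le> n" for k b w
    proof (cases "k = n")
      case True
      then show ?thesis by (simp add: u_def cube_mean_upd coord_diff_def[abs_def])
    qed (use that in \<open>simp add: u_def cube_mean_upd_less\<close>)
    then have "cube_mean m (\<lambda>w. (u n w)\<^sup>2) w = (u n w)\<^sup>2" if "m \<le> Suc n" for m w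
      using that by (induction m arbitrary: w) (simp_all add: coord_mean_def)
    then show ?thesis by blast
  qed
  moreover have "u n w = coord_diff n (cube_mean n g) w"
    by (simp add: u_def coord_diff_cube_mean)
  moreover have "(\<Sum>j<n. cube_mean (Suc n) (\<lambda>w. (u j w)\<^sup>2) w)
      = coord_mean n (\<lambda>w. \<Sum>j<n. cube_mean n (\<lambda>w. (u j w)\<^sup>2) w) w"
    by (simp add: coord_mean_def sum.distrib sum_divide_distrib[symmetric])
  ultimately have "(\<Sum>j<Suc n. cube_mean (Suc n) (\<lambda>w. (u j w)\<^sup>2) w)
      = coord_mean n (\<lambda>w. cube_mean n (\<lambda>w. (g w)\<^sup>2) w - (cube_mean n g w)\<^sup>2) w
        + (coord_diff n (cube_mean n g) w)\<^sup>2"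
    using Suc by (simp add: u_def)
  also have "\<dots> = cube_mean (Suc n) (\<lambda>w. (g w)\<^sup>2) w - (cube_mean (Suc n) g w)\<^sup>2"
    by (simp add: coord_mean_def coord_diff_def power2_eq_square field_simps)
  finally show ?case by (simp add: u_def)
qed simp

text \<open>Integrate the tangent bound \<open>u\<^sup>2 ln \<bar>u\<bar> \<ge> u\<^sup>2 (1 + ln s) - s \<bar>u\<bar>\<close>; the choice
  \<open>s = exp (L / 2) * sqrt v\<close> makes the error term accessible to the AM-GM inequality.\<close>

lemma cube_entropy_ge:
  fixes L :: real and n :: nat and w :: "nat \<Rightarrow> bool"
  defines "E \<equiv> \<lambda>g. cube_mean n g w"
  shows "(L + 1) * E (\<lambda>w. (u w)\<^sup>2) - exp L * (E (\<lambda>w. \<bar>u w\<bar>))\<^sup>2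
    \<le> E (\<lambda>w. (u w)\<^sup>2 * ln ((u w)\<^sup>2)) - E (\<lambda>w. (u w)\<^sup>2) * ln (E (\<lambda>w. (u w)\<^sup>2))"
proof -
  define v where "v = E (\<lambda>w. (u w)\<^sup>2)"
  define a where "a = E (\<lambda>w. \<bar>u w\<bar>)"
  define e where "e = E (\<lambda>w. (u w)\<^sup>2 * ln ((u w)\<^sup>2))"
  have v: "0 \<le> v" and a: "0 \<le> a" by (auto simp: v_def a_def E_def intro!: cube_mean_nonneg)
  have tangent: "2 * (1 + ln s) * v - 2 * s * a \<le> e" if s: "0 < s" for s
  proof -
    have pt: "2 * (1 + ln s) * x\<^sup>2 - 2 * s * \<bar>x\<bar> \<le> x\<^sup>2 * ln (x\<^sup>2)" for x :: real
    proof (cases "x = 0")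
      case False
      then have "ln (s / \<bar>x\<bar>) \<le> s / \<bar>x\<bar> - 1" using s by (intro ln_le_minus_one) simp
      with False s have "1 + ln s - s / \<bar>x\<bar> \<le> ln \<bar>x\<bar>" by (simp add: ln_div)
      then have "2 * x\<^sup>2 * (1 + ln s - s / \<bar>x\<bar>) \<le> 2 * x\<^sup>2 * ln \<bar>x\<bar>"
        by (intro mult_left_mono) auto
      moreover have "2 * x\<^sup>2 * (1 + ln s - s / \<bar>x\<bar>) = 2 * (1 + ln s) * x\<^sup>2 - 2 * s * \<bar>x\<bar>"
        using False by (simp add: field_simps power2_eq_square abs_if)
      moreover have "ln (x\<^sup>2) = 2 * ln \<bar>x\<bar>"
        using False ln_realpow[of "\<bar>x\<bar>" 2] by simp
      ultimately show ?thesis by simp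
    qed simp
    have "cube_mean n (\<lambda>w. 2 * (1 + ln s) * (u w)\<^sup>2 - 2 * s * \<bar>u w\<bar>) w \<le> e"
      unfolding e_def E_def by (intro cube_mean_mono pt)
    then show ?thesis
      by (simp only: cube_mean_diff cube_mean_cmult v_def a_def E_def)
  qed
  have "(L + 1) * v - exp L * a\<^sup>2 \<le> e - v * ln v"
  proof (cases "v = 0")
    case True
    show ?thesis
    proof (cases "a = 0")
      case True
      with tangent[of 1] \<open>v = 0\<close> show ?thesis by simp
    next
      case False
      \<comment> \<open>This \<open>s\<close> satisfies
        \<open>2 * s * a = exp L * a\<^sup>2\<close>, so the tangent bound is the claim itself and
        the subcase needs no contradiction.\<close>
      with tangent[of "exp L * a / 2"] a \<open>v = 0\<close> show ?thesis
        by (simp add: power2_eq_square mult.assoc)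
    qed
  next
    case False
    with v have v: "0 < v" by simp
    define s where "s = exp (L / 2) * sqrt v"
    have "ln s = L / 2 + ln v / 2" using v by (simp add: s_def ln_mult ln_sqrt)
    moreover have "2 * s * a \<le> v + exp L * a\<^sup>2"
    proof -
      have "2 * sqrt v * (exp (L / 2) * a) \<le> (sqrt v)\<^sup>2 + (exp (L / 2) * a)\<^sup>2"
        by (rule sum_squares_bound)
      moreover have "(exp (L / 2))\<^sup>2 = exp L" by (simp add: exp_double[symmetric])
      ultimately show ?thesis using v by (simp add: s_def power_mult_distrib mult_ac)
    qed
    ultimately show ?thesis using tangent[of s] v by (simp add: s_def algebra_simps)
  qed
  then show ?thesis by (simp add: v_def a_def e_def)
qed

text \<open>For each \<open>j\<close> the logarithmic Sobolev upper bound and the lower bound for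
  the entropy of \<open>(u j)\<^sup>2\<close> are chained; summing over \<open>j\<close> recovers
  the variance. Nothing is lost on the right because the \<open>u j\<close> together have no more
  energy in any direction \<open>i\<close> than \<open>g\<close> has.\<close>

lemma cube_falik_samorodnitsky:
  "(L + 1) * (cube_mean n (\<lambda>w. (g w)\<^sup>2) w - (cube_mean n g w)\<^sup>2)
   \<le> 4 * (\<Sum>i<n. cube_mean n (\<lambda>w. (coord_diff i g w)\<^sup>2) w)
     + exp L * (\<Sum>j<n. (cube_mean n (\<lambda>w. \<bar>coord_diff j g w\<bar>) w)\<^sup>2)"
proof -
  define u where "u = (\<lambda>j. cube_mean j (coord_diff j g))"
  have abs_u: "cube_mean n (\<lambda>w. \<bar>u j w\<bar>) w \<le> cube_mean n (\<lambda>w. \<bar>coord_diff j g w\<bar>) w"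
    if "j < n" for j
  proof -
    have "cube_mean n (\<lambda>w. \<bar>u j w\<bar>) w \<le> cube_mean n (cube_mean j (\<lambda>w. \<bar>coord_diff j g w\<bar>)) w"
      unfolding u_def by (intro cube_mean_mono abs_cube_mean_le)
    with that show ?thesis by (simp add: cube_mean_cube_mean)
  qed
  \<comment> \<open>For \<open>i < j\<close> bit \<open>i\<close> is already averaged out and the
    left side vanishes; otherwise the operators commute and equality holds.\<close>
  have diff_u: "(coord_diff i (u j) w)\<^sup>2 \<le> (cube_mean j (coord_diff j (coord_diff i g)) w)\<^sup>2" for i j w
  proof (cases "i < j")
    case True
    then show ?thesis by (simp add: u_def coord_diff_cube_mean_eq_0)
  next
    case False
    then show ?thesis by (simp add: u_def coord_diff_cube_mean coord_diff_commute[of i j])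
  qed
  \<comment> \<open>The variance decomposition is used a second time, now for
    \<open>coord_diff i g\<close>, whose variance is at most its second moment.\<close>
  have sum_diff_u: "(\<Sum>j<n. cube_mean n (\<lambda>w. (coord_diff i (u j) w)\<^sup>2) w)
      \<le> cube_mean n (\<lambda>w. (coord_diff i g w)\<^sup>2) w" for i
  proof -
    have "(\<Sum>j<n. cube_mean n (\<lambda>w. (coord_diff i (u j) w)\<^sup>2) w)
        \<le> (\<Sum>j<n. cube_mean n (\<lambda>w. (cube_mean j (coord_diff j (coord_diff i g)) w)\<^sup>2) w)"
      by (intro sum_mono cube_mean_mono diff_u)
    also have "\<dots> = cube_mean n (\<lambda>w. (coord_diff i g w)\<^sup>2) w - (cube_mean n (coord_diff i g) w)\<^sup>2"
      by (rule cube_variance_decomposition[symmetric])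
    finally show ?thesis using zero_le_power2[of "cube_mean n (coord_diff i g) w"] by linarith
  qed
  have "(L + 1) * (cube_mean n (\<lambda>w. (g w)\<^sup>2) w - (cube_mean n g w)\<^sup>2)
      = (\<Sum>j<n. (L + 1) * cube_mean n (\<lambda>w. (u j w)\<^sup>2) w)"
    unfolding cube_variance_decomposition by (simp add: u_def sum_distrib_left)
  also have "\<dots> \<le> (\<Sum>j<n. exp L * (cube_mean n (\<lambda>w. \<bar>u j w\<bar>) w)\<^sup>2
      + 4 * (\<Sum>i<n. cube_mean n (\<lambda>w. (coord_diff i (u j) w)\<^sup>2) w))"
  proof (rule sum_mono)
    fix j
    show "(L + 1) * cube_mean n (\<lambda>w. (u j w)\<^sup>2) w \<le> exp L * (cube_mean n (\<lambda>w. \<bar>u j w\<bar>) w)\<^sup>2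
      + 4 * (\<Sum>i<n. cube_mean n (\<lambda>w. (coord_diff i (u j) w)\<^sup>2) w)"
      using cube_log_sobolev[of n "u j" w] cube_entropy_ge[of L n "u j" w] by linarith
  qed
  also have "\<dots> = exp L * (\<Sum>j<n. (cube_mean n (\<lambda>w. \<bar>u j w\<bar>) w)\<^sup>2)
      + 4 * (\<Sum>i<n. \<Sum>j<n. cube_mean n (\<lambda>w. (coord_diff i (u j) w)\<^sup>2) w)"
    by (subst sum.swap[of _ "{..<n}" "{..<n}"]) (simp add: sum.distrib sum_distrib_left)
  also have "\<dots> \<le> exp L * (\<Sum>j<n. (cube_mean n (\<lambda>w. \<bar>coord_diff j g w\<bar>) w)\<^sup>2)
      + 4 * (\<Sum>i<n. cube_mean n (\<lambda>w. (coord_diff i g w)\<^sup>2) w)"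
    by (intro add_mono mult_left_mono sum_mono power_mono sum_diff_u abs_u cube_mean_nonneg) auto
  finally show ?thesis by simp
qed

section \<open>The infinite cube\<close>

lemma prob_space_Cube: "prob_space Cube"
  unfolding Cube_def by (intro prob_space_PiM prob_space_measure_pmf)

interpretation Cube: prob_space Cube
  by (rule prob_space_Cube)

lemma space_Cube [simp]: "space Cube = UNIV"
  by (simp add: Cube_def space_PiM)

lemma measurable_Cube_coord [measurable]: "(\<lambda>w. w i) \<in> measurable Cube (count_space UNIV)"
proof -
  have "(\<lambda>w. w i) \<in> measurable Cube (measure_pmf (bernoulli_pmf (1/2)))"
    unfolding Cube_def by (rule measurable_component_singleton) simp
  then show ?thesis by simp
qed

lemma measurable_flip_bit [measurable]: "flip_bit k \<in> measurable Cube Cube"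
proof -
  have "(\<lambda>w i. if i = k then \<not> w i else w i) \<in> measurable Cube (PiM UNIV (\<lambda>_. measure_pmf (bernoulli_pmf (1/2))))"
  proof (rule measurable_PiM_single')
    fix i
    show "(\<lambda>w. if i = k then \<not> w i else w i) \<in> measurable Cube (measure_pmf (bernoulli_pmf (1/2)))"
      by simp
  qed simp
  moreover have "(\<lambda>w i. if i = k then \<not> w i else w i) = flip_bit k"
    by (auto simp: flip_bit_def fun_eq_iff)
  ultimately show ?thesis by (simp add: Cube_def)
qed

text \<open>A product measure is determined by finite-dimensional boxes. Pulling a box back along
  the flip changes only the factor at \<open>k\<close>, into its preimage under negation, and the
  fair coin is invariant under negation.\<close>

lemma distr_Cube_flip_bit: "distr Cube Cube (flip_bit k) = Cube"
proof -
  let ?B = "measure_pmf (bernoulli_pmf (1/2))"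
  interpret product_prob_space "\<lambda>_. ?B" "UNIV :: nat set"
    by unfold_locales
  have "distr Cube Cube (flip_bit k) = PiM UNIV (\<lambda>_. ?B)"
  proof (rule PiM_eq)
    show "sets (distr Cube Cube (flip_bit k)) = sets (PiM UNIV (\<lambda>_. ?B))"
      by (simp add: Cube_def)
    fix J :: "nat set" and F :: "nat \<Rightarrow> bool set"
    assume J: "finite J" "J \<subseteq> UNIV" and F: "\<And>j. j \<in> J \<Longrightarrow> F j \<in> sets ?B"
    define F' where "F' = (\<lambda>j. if j = k then Not -` F j else F j)"
    have "flip_bit k -` prod_emb UNIV (\<lambda>_. ?B) J (Pi\<^sub>E J F) = prod_emb UNIV (\<lambda>_. ?B) J (Pi\<^sub>E J F')"
      by (auto simp: prod_emb_def PiE_iff F'_def flip_bit_def split: if_splits)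
    moreover have "prod_emb UNIV (\<lambda>_. ?B) J (Pi\<^sub>E J F) \<in> sets Cube"
      unfolding Cube_def using J F by (intro sets_PiM_I) auto
    ultimately have "emeasure (distr Cube Cube (flip_bit k)) (prod_emb UNIV (\<lambda>_. ?B) J (Pi\<^sub>E J F))
        = emeasure Cube (prod_emb UNIV (\<lambda>_. ?B) J (Pi\<^sub>E J F'))"
      by (simp add: emeasure_distr)
    also have "\<dots> = emeasure (PiM UNIV (\<lambda>_. ?B)) (prod_emb UNIV (\<lambda>_. ?B) J (Pi\<^sub>E J F'))"
      by (simp only: Cube_def)
    also have "\<dots> = (\<Prod>j\<in>J. emeasure ?B (F' j))"
      using J by (intro emeasure_PiM_emb) auto
    also have "\<dots> = (\<Prod>j\<in>J. emeasure ?B (F j))"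
    proof (rule prod.cong)
      fix j
      have "map_pmf Not (bernoulli_pmf (1/2)) = bernoulli_pmf (1/2)"
      proof (rule pmf_eqI)
        fix b
        \<comment> \<open>Writing \<open>b\<close> as a double negation exhibits it as an image
          point, the form that \<open>pmf_map_inj'\<close> expects.\<close>
        have "pmf (map_pmf Not (bernoulli_pmf (1/2))) (Not (\<not> b)) = pmf (bernoulli_pmf (1/2)) (\<not> b)"
          by (rule pmf_map_inj') (auto simp: inj_def)
        then show "pmf (map_pmf Not (bernoulli_pmf (1/2))) b = pmf (bernoulli_pmf (1/2)) b"
          by (cases b) auto
      qed
      then have "emeasure ?B (Not -` F j) = emeasure ?B (F j)"
        by (metis emeasure_map_pmf)
      then show "emeasure ?B (F' j) = emeasure ?B (F j)" by (auto simp: F'_def)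
    qed simp
    finally show "emeasure (distr Cube Cube (flip_bit k)) (prod_emb UNIV (\<lambda>_. ?B) J (Pi\<^sub>E J F))
        = (\<Prod>j\<in>J. emeasure ?B (F j))" .
  qed
  then show ?thesis by (simp add: Cube_def)
qed

lemma flip_bit_flip_bit [simp]: "flip_bit k (flip_bit k w) = w"
  by (auto simp: flip_bit_def)

lemma integral_flip_bit:
  fixes F :: "(nat \<Rightarrow> bool) \<Rightarrow> real"
  assumes [measurable]: "F \<in> borel_measurable Cube"
  shows "(\<integral>w. F (flip_bit k w) \<partial>Cube) = (\<integral>w. F w \<partial>Cube)"
  by (subst (2) distr_Cube_flip_bit[of k, symmetric]) (simp add: integral_distr)

lemma integrable_flip_bit:
  fixes F :: "(nat \<Rightarrow> bool) \<Rightarrow> real"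
  assumes F: "integrable Cube F"
  shows "integrable Cube (\<lambda>w. F (flip_bit k w))"
proof -
  have "integrable (distr Cube Cube (flip_bit k)) F"
    using F by (simp add: distr_Cube_flip_bit)
  then show ?thesis by (subst (asm) integrable_distr_eq) (use F in auto)
qed

lemma AE_flip_bit:
  assumes "AE w in Cube. P w"
  shows "AE w in Cube. P (flip_bit k w)"
proof (rule AE_distrD[of "flip_bit k" _ Cube])
  show "AE w in distr Cube Cube (flip_bit k). P w"
    unfolding distr_Cube_flip_bit by (rule assms)
qed simp

section \<open>Conditional averages over cylinders\<close>

definition cylinder :: "nat \<Rightarrow> (nat \<Rightarrow> bool) \<Rightarrow> (nat \<Rightarrow> bool) set" where
  "cylinder n w = {\<eta>. \<forall>i<n. \<eta> i = w i}"

lemma sets_cylinder [measurable]: "cylinder n w \<in> sets Cube"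
proof -
  have "{\<eta> \<in> space Cube. \<forall>i<n. \<eta> i = w i} \<in> sets Cube" by measurable
  then show ?thesis by (simp add: cylinder_def)
qed

lemma cylinder_eq: "\<eta> \<in> cylinder n w \<Longrightarrow> cylinder n \<eta> = cylinder n w"
  by (auto simp: cylinder_def)

lemma cylinder_flip_bit: "n \<le> k \<Longrightarrow> cylinder n (flip_bit k w) = cylinder n w"
  by (auto simp: cylinder_def flip_bit_def)

text \<open>The conditional expectation given the first \<open>n\<close> bits, since each cylinder
  has probability \<open>1 / 2 ^ n\<close>. An explicit version, defined at every point, can be fed
  directly into the finite-cube lemmas.\<close>

definition cyl_mean :: "nat \<Rightarrow> ((nat \<Rightarrow> bool) \<Rightarrow> real) \<Rightarrow> (nat \<Rightarrow> bool) \<Rightarrow> real" where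
  "cyl_mean n F w = 2 ^ n * (\<integral>\<eta>. F \<eta> * indicator (cylinder n w) \<eta> \<partial>Cube)"

lemma coord_mean_cyl_mean:
  assumes F: "integrable Cube F"
  shows "coord_mean n (cyl_mean (Suc n) F) = cyl_mean n F"
proof
  fix w
  let ?I = "\<lambda>b. \<integral>\<eta>. F \<eta> * indicator (cylinder (Suc n) (w(n := b))) \<eta> \<partial>Cube"
  have "(\<integral>\<eta>. F \<eta> * indicator (cylinder n w) \<eta> \<partial>Cube)
      = (\<integral>\<eta>. F \<eta> * indicator (cylinder (Suc n) (w(n := True))) \<eta>
           + F \<eta> * indicator (cylinder (Suc n) (w(n := False))) \<eta> \<partial>Cube)"
    by (rule Bochner_Integration.integral_cong)
      (auto simp: cylinder_def less_Suc_eq split: split_indicator)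
  also have "\<dots> = ?I True + ?I False"
    by (intro Bochner_Integration.integral_add integrable_real_mult_indicator F sets_cylinder)
  finally show "coord_mean n (cyl_mean (Suc n) F) w = cyl_mean n F w"
    by (simp add: coord_mean_def cyl_mean_def algebra_simps)
qed

text \<open>The bridge from integrals to finite averages. In the induction step the average over bit
  \<open>n\<close> is commuted inside, where it merges the two halves of a cylinder.\<close>

lemma cube_mean_cyl_mean:
  assumes F: "integrable Cube F"
  shows "cube_mean n (cyl_mean n F) w = (\<integral>\<eta>. F \<eta> \<partial>Cube)"
proof (induction n)
  case 0
  then show ?case by (simp add: cyl_mean_def cylinder_def)
next
  case (Suc n)
  then show ?case by (simp add: coord_mean_cube_mean coord_mean_cyl_mean[OF F])
qed

lemma cyl_mean_flip_bit:
  assumes [measurable]: "F \<in> borel_measurable Cube" and "k < n"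
  shows "cyl_mean n (\<lambda>\<eta>. F (flip_bit k \<eta>)) w = cyl_mean n F (flip_bit k w)"
proof -
  have "(\<lambda>\<eta>. F (flip_bit k \<eta>) * indicator (cylinder n w) \<eta>)
      = (\<lambda>\<eta>. F (flip_bit k \<eta>) * indicator (cylinder n (flip_bit k w)) (flip_bit k \<eta>))"
    using \<open>k < n\<close> by (auto simp: fun_eq_iff cylinder_def flip_bit_def split: split_indicator)
  then show ?thesis
    unfolding cyl_mean_def
    by (simp add: integral_flip_bit[of "\<lambda>\<eta>. F \<eta> * indicator (cylinder n (flip_bit k w)) \<eta>"])
qed

lemma cyl_mean_upd:
  assumes "F \<in> borel_measurable Cube" and "k < n" and "\<And>\<eta>. F (flip_bit k \<eta>) = F \<eta>"
  shows "cyl_mean n F (w(k := b)) = cyl_mean n F w"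
proof (cases "w k = b")
  case False
  then have "w(k := b) = flip_bit k w" by (auto simp: flip_bit_def)
  with cyl_mean_flip_bit[OF assms(1,2), of w] assms(3) show ?thesis by simp
qed (simp add: fun_upd_idem)

text \<open>The two halves of a cylinder have equal mass by flip invariance, so the probability
  \<open>1 / 2 ^ n\<close> follows by induction without evaluating the product measure.\<close>

lemma cyl_mean_one: "cyl_mean n (\<lambda>_. 1) w = 1"
proof (induction n)
  case 0
  then show ?case using Cube.prob_space by (simp add: cyl_mean_def cylinder_def)
next
  case (Suc n)
  have "cyl_mean (Suc n) (\<lambda>_. 1) w = coord_mean n (cyl_mean (Suc n) (\<lambda>_. 1)) w"
    by (simp add: coord_mean_def cyl_mean_upd)
  with Suc show ?case by (simp add: coord_mean_cyl_mean)
qed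

lemma cyl_mean_mono:
  assumes "integrable Cube F" "integrable Cube G" "\<And>\<eta>. F \<eta> \<le> G \<eta>"
  shows "cyl_mean n F w \<le> cyl_mean n G w"
  unfolding cyl_mean_def
  by (intro mult_left_mono integral_mono integrable_real_mult_indicator sets_cylinder assms mult_right_mono) auto

lemma abs_cyl_mean_le: "\<bar>cyl_mean n F w\<bar> \<le> cyl_mean n (\<lambda>\<eta>. \<bar>F \<eta>\<bar>) w"
proof -
  have "\<bar>\<integral>\<eta>. F \<eta> * indicator (cylinder n w) \<eta> \<partial>Cube\<bar> \<le> (\<integral>\<eta>. \<bar>F \<eta> * indicator (cylinder n w) \<eta>\<bar> \<partial>Cube)"
    by (rule integral_abs_bound)
  also have "\<dots> = (\<integral>\<eta>. \<bar>F \<eta>\<bar> * indicator (cylinder n w) \<eta> \<partial>Cube)"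
    by (simp add: abs_mult)
  finally show ?thesis by (simp add: cyl_mean_def abs_mult mult_left_mono)
qed

text \<open>Evaluating at the flipped point amounts to averaging the flipped function, so
  \<open>coord_diff\<close> passes inside the average, and then so does the absolute value.\<close>

lemma abs_coord_diff_cyl_mean_le:
  assumes F: "integrable Cube F" and k: "k < n"
  shows "\<bar>coord_diff k (cyl_mean n F) w\<bar> \<le> cyl_mean n (\<lambda>\<eta>. \<bar>F \<eta> - F (flip_bit k \<eta>)\<bar> / 2) w"
proof -
  let ?v = "w(k := True)"
  let ?G = "\<lambda>\<eta>. (F \<eta> - F (flip_bit k \<eta>)) / 2"
  have [measurable]: "F \<in> borel_measurable Cube" using F by simp
  have v: "flip_bit k ?v = w(k := False)" by (auto simp: flip_bit_def)
  have "coord_diff k (cyl_mean n F) w = (cyl_mean n F ?v - cyl_mean n (\<lambda>\<eta>. F (flip_bit k \<eta>)) ?v) / 2"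
    using k by (simp add: coord_diff_def cyl_mean_flip_bit v)
  also have "\<dots> = 2 ^ n * ((\<integral>\<eta>. F \<eta> * indicator (cylinder n ?v) \<eta> - F (flip_bit k \<eta>) * indicator (cylinder n ?v) \<eta> \<partial>Cube) / 2)"
    unfolding cyl_mean_def
    by (subst Bochner_Integration.integral_diff)
      (auto intro!: integrable_real_mult_indicator F integrable_flip_bit simp: right_diff_distrib)
  also have "\<dots> = cyl_mean n ?G ?v"
    unfolding cyl_mean_def integral_divide_zero[symmetric]
    by (simp add: left_diff_distrib diff_divide_distrib)
  finally have "\<bar>coord_diff k (cyl_mean n F) w\<bar> \<le> cyl_mean n (\<lambda>\<eta>. \<bar>?G \<eta>\<bar>) ?v"
    by (simp only: abs_cyl_mean_le)
  also have "(\<lambda>\<eta>. \<bar>?G \<eta>\<bar>) = (\<lambda>\<eta>. \<bar>F \<eta> - F (flip_bit k \<eta>)\<bar> / 2)" by simp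
  \<comment> \<open>The integrand is symmetric under flipping bit \<open>k\<close>, so its cylinder
    average ignores that bit.\<close>
  also have "cyl_mean n \<dots> ?v = cyl_mean n \<dots> w"
    using k by (intro cyl_mean_upd) auto
  finally show ?thesis .
qed

section \<open>Finitary functions\<close>

lemma integrable_Cube_indicator:
  "A \<in> sets Cube \<Longrightarrow> integrable Cube (indicator A :: (nat \<Rightarrow> bool) \<Rightarrow> real)"
  by (intro integrable_real_indicator) (auto simp: less_top[symmetric])

text \<open>Such a predicate is a finite union over patterns of the first \<open>n\<close> bits; a
  pattern is coded by the set \<open>S\<close> of positions holding \<open>True\<close>.\<close>

lemma pred_Cube_first_bits:
  assumes "\<And>w \<eta>. \<eta> \<in> cylinder n w \<Longrightarrow> P \<eta> = P w"
  shows "Measurable.pred Cube P"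
proof -
  have P: "P w = (\<exists>S\<in>Pow {..<n}. P (\<lambda>i. i \<in> S) \<and> (\<forall>i<n. w i = (i \<in> S)))" for w
  proof
    assume "P w"
    let ?S = "{i. i < n \<and> w i}"
    have "(\<lambda>i. i \<in> ?S) \<in> cylinder n w" by (auto simp: cylinder_def)
    with \<open>P w\<close> assms have "P (\<lambda>i. i \<in> ?S)" by blast
    then show "\<exists>S\<in>Pow {..<n}. P (\<lambda>i. i \<in> S) \<and> (\<forall>i<n. w i = (i \<in> S))"
      by (intro bexI[of _ ?S]) auto
  next
    assume "\<exists>S\<in>Pow {..<n}. P (\<lambda>i. i \<in> S) \<and> (\<forall>i<n. w i = (i \<in> S))"
    then obtain S where "P (\<lambda>i. i \<in> S)" "w \<in> cylinder n (\<lambda>i. i \<in> S)" by (auto simp: cylinder_def)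
    then show "P w" using assms by blast
  qed
  have "Measurable.pred Cube (\<lambda>w. \<exists>S\<in>Pow {..<n}. P (\<lambda>i. i \<in> S) \<and> (\<forall>i<n. w i = (i \<in> S)))"
    by measurable
  then show ?thesis by (simp add: P[symmetric])
qed

section \<open>Decided cylinders and witness sets\<close>

text \<open>The value \<open>b\<close> is a separate argument instead of \<open>f w\<close>, so that
  for fixed \<open>b\<close> the predicate depends only on the first \<open>n\<close> bits of
  \<open>w\<close> and is therefore measurable.\<close>

definition decided :: "((nat \<Rightarrow> bool) \<Rightarrow> bool) \<Rightarrow> nat \<Rightarrow> (nat \<Rightarrow> bool) \<Rightarrow> bool \<Rightarrow> bool" where
  "decided f n w b \<longleftrightarrow> (AE \<eta> in Cube. \<eta> \<in> cylinder n w \<longrightarrow> f \<eta> = b)"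

lemma decided_cong: "\<eta> \<in> cylinder n w \<Longrightarrow> decided f n \<eta> b = decided f n w b"
  by (simp add: decided_def cylinder_eq)

lemma witness_iff_AE: "witness f w W \<longleftrightarrow> (AE \<eta> in Cube. (\<forall>i\<in>W. \<eta> i = w i) \<longrightarrow> f \<eta> = f w)"
proof
  assume "witness f w W"
  then obtain A where "A \<in> sets Cube" "Cube.prob A = 1"
    and A: "\<forall>\<eta>\<in>A. (\<forall>i\<in>W. \<eta> i = w i) \<longrightarrow> f \<eta> = f w"
    unfolding witness_def by blast
  then have "AE \<eta> in Cube. \<eta> \<in> A" by (simp add: Cube.prob_eq_1)
  then show "AE \<eta> in Cube. (\<forall>i\<in>W. \<eta> i = w i) \<longrightarrow> f \<eta> = f w" by eventually_elim (use A in blast)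
next
  assume "AE \<eta> in Cube. (\<forall>i\<in>W. \<eta> i = w i) \<longrightarrow> f \<eta> = f w"
  then obtain N where N: "N \<in> null_sets Cube" "{\<eta> \<in> space Cube. \<not> ((\<forall>i\<in>W. \<eta> i = w i) \<longrightarrow> f \<eta> = f w)} \<subseteq> N"
    unfolding eventually_ae_filter by blast
  then have "Cube.prob (space Cube - N) = 1"
    by (subst Cube.prob_compl) (auto simp: measure_def null_sets_def)
  moreover have "\<forall>\<eta>\<in>space Cube - N. (\<forall>i\<in>W. \<eta> i = w i) \<longrightarrow> f \<eta> = f w"
    using N(2) by blast
  moreover have "space Cube - N \<in> sets Cube" using N(1) by (intro sets.compl_sets) auto
  ultimately show "witness f w W" unfolding witness_def by blast
qed

lemma witness_lessThan_iff: "witness f w {..<n} \<longleftrightarrow> decided f n w (f w)"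
  by (simp add: witness_iff_AE decided_def cylinder_def Ball_def)

lemma witness_mono: "witness f w W \<Longrightarrow> W \<subseteq> V \<Longrightarrow> witness f w V"
  unfolding witness_def by (meson subsetD)

text \<open>Witness sets are closed under enlargement, so only the initial segment
  \<open>{..<n}\<close> has to be tested. This turns \<open>maxW\<close> into the length of the
  shortest deciding cylinder.\<close>

lemma bounded_witness_iff:
  "(\<exists>W. finite W \<and> witness f w W \<and> (\<forall>i\<in>W. i < n)) \<longleftrightarrow> decided f n w (f w)"
proof
  assume "\<exists>W. finite W \<and> witness f w W \<and> (\<forall>i\<in>W. i < n)"
  then have "witness f w {..<n}" by (meson lessThan_iff subsetI witness_mono)
  then show "decided f n w (f w)" by (simp add: witness_lessThan_iff)
next
  assume "decided f n w (f w)"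
  then have "witness f w {..<n}" by (simp add: witness_lessThan_iff)
  then show "\<exists>W. finite W \<and> witness f w W \<and> (\<forall>i\<in>W. i < n)"
    by (intro exI[of _ "{..<n}"]) simp
qed

lemma maxW_eq_Least: "maxW f w = (LEAST n. decided f n w (f w))"
  unfolding maxW_def bounded_witness_iff ..

lemma measurable_maxW [measurable]:
  assumes f: "boolean_function f"
  shows "maxW f \<in> measurable Cube (count_space UNIV)"
proof -
  have [measurable]: "f \<in> measurable Cube (count_space UNIV)"
    using f by (simp add: boolean_function_def)
  have [measurable]: "Measurable.pred Cube (\<lambda>w. decided f n w b)" for n b
    by (rule pred_Cube_first_bits) (rule decided_cong)
  have eq: "decided f n w (f w) = (f w \<and> decided f n w True \<or> \<not> f w \<and> decided f n w False)" for n w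
    by (cases "f w") auto
  show ?thesis unfolding maxW_eq_Least[abs_def] eq by measurable
qed

text \<open>\<open>decided\<close> speaks of almost every point of a cylinder, with an exceptional
  set that depends on the cylinder. There are only countably many cylinders, so the exceptional sets
  can be united.\<close>

lemma AE_decided_imp: "AE w in Cube. \<forall>n b. decided f n w b \<longrightarrow> f w = b"
proof -
  have cyl: "AE w in Cube. \<forall>S\<in>Pow {..<n}. decided f n (\<lambda>i. i \<in> S) b \<longrightarrow>
      w \<in> cylinder n (\<lambda>i. i \<in> S) \<longrightarrow> f w = b" for n b
    by (intro AE_ball_countable[THEN iffD2] ballI AE_impI countable_finite)
      (auto simp: decided_def)
  have "AE w in Cube. decided f n w b \<longrightarrow> f w = b" for n b
    using cyl[of n b]
  proof eventually_elim
    case (elim w)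
    let ?S = "{i. i < n \<and> w i}"
    have "w \<in> cylinder n (\<lambda>i. i \<in> ?S)" by (auto simp: cylinder_def)
    moreover from this have "decided f n (\<lambda>i. i \<in> ?S) b = decided f n w b"
      by (rule decided_cong[symmetric])
    moreover have "?S \<in> Pow {..<n}" by auto
    ultimately show ?case using elim by blast
  qed
  then show ?thesis by (simp add: AE_all_countable)
qed

lemma AE_decided_maxW:
  assumes "finitary f"
  shows "AE w in Cube. decided f (maxW f w) w (f w)"
  using assms unfolding finitary_def
proof eventually_elim
  case (elim w)
  then obtain W where W: "finite W" "witness f w W" by blast
  then obtain n where "\<forall>i\<in>W. i < n" by (meson finite_nat_set_iff_bounded)
  with W have "decided f n w (f w)" using bounded_witness_iff by blast
  then show ?case unfolding maxW_eq_Least by (rule LeastI)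
qed

section \<open>Influences and variance of finitary functions\<close>

lemma decided_mono: "decided f m w b \<Longrightarrow> m \<le> n \<Longrightarrow> decided f n w b"
  unfolding decided_def by (elim eventually_mono) (auto simp: cylinder_def)

lemma influence_eq_integral:
  "influence f k = (\<integral>\<eta>. \<bar>sgnb (f \<eta>) - sgnb (f (flip_bit k \<eta>))\<bar> / 2 \<partial>Cube)"
proof -
  have "(\<lambda>\<eta>. \<bar>sgnb (f \<eta>) - sgnb (f (flip_bit k \<eta>))\<bar> / 2)
      = indicator {w \<in> space Cube. f (flip_bit k w) \<noteq> f w}"
    by (auto simp: fun_eq_iff sgnb_def split: split_indicator)
  then show ?thesis by (simp add: influence_def)
qed

lemma influence_le_prob_maxW:
  assumes f: "boolean_function f" and "finitary f"
  shows "influence f k \<le> Cube.prob {w. k < maxW f w}"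
  unfolding influence_def
proof (rule Cube.finite_measure_mono_AE)
  note [measurable] = measurable_maxW[OF f]
  have "{w \<in> space Cube. k < maxW f w} \<in> sets Cube" by measurable
  then show "{w. k < maxW f w} \<in> sets Cube" by simp
  show "AE w in Cube. w \<in> {w \<in> space Cube. f (flip_bit k w) \<noteq> f w} \<longrightarrow> w \<in> {w. k < maxW f w}"
    \<comment> \<open>If \<open>maxW f w \<le> k\<close>, the flipped point lies in the same
      deciding cylinder. Pulling the second fact back along the flip keeps the flipped point, too,
      off the exceptional null set.\<close>
    using AE_decided_maxW[OF \<open>finitary f\<close>] AE_flip_bit[OF AE_decided_imp[of f], of k]
  proof eventually_elim
    case (elim w)
    have "f (flip_bit k w) = f w" if "maxW f w \<le> k"
    proof -
      have "decided f (maxW f w) (flip_bit k w) (f w)"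
        using elim(1) that by (simp add: decided_def cylinder_flip_bit)
      with elim(2) show ?thesis by blast
    qed
    then show ?case by fastforce
  qed
qed

text \<open>On a decided cylinder the average of the sign is 1 or -1, so the right side is 1. On any
  other cylinder almost no point has \<open>maxW\<close> at most \<open>n\<close>, so the left side
  is 0.\<close>

lemma cyl_mean_sgnb_sq_ge:
  assumes f: "boolean_function f" and "finitary f"
  shows "cyl_mean n (indicator {w. maxW f w \<le> n}) w \<le> (cyl_mean n (\<lambda>\<eta>. sgnb (f \<eta>)) w)\<^sup>2"
proof -
  note [measurable] = measurable_maxW[OF f]
  have [measurable]: "f \<in> measurable Cube (count_space UNIV)"
    using f by (simp add: boolean_function_def)
  have "{w \<in> space Cube. maxW f w \<le> n} \<in> sets Cube" by measurable
  then have [measurable]: "{w. maxW f w \<le> n} \<in> sets Cube" by simp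
  show ?thesis
  proof (cases "\<exists>b. decided f n w b")
    case True
    then obtain b where b: "AE \<eta> in Cube. \<eta> \<in> cylinder n w \<longrightarrow> f \<eta> = b" by (auto simp: decided_def)
    have "(\<integral>\<eta>. sgnb (f \<eta>) * indicator (cylinder n w) \<eta> \<partial>Cube)
        = (\<integral>\<eta>. sgnb b * (1 * indicator (cylinder n w) \<eta>) \<partial>Cube)"
      by (rule integral_cong_AE) (use b in \<open>auto simp: indicator_def\<close>)
    then have "cyl_mean n (\<lambda>\<eta>. sgnb (f \<eta>)) w = sgnb b * cyl_mean n (\<lambda>_. 1) w"
      by (simp add: cyl_mean_def)
    then have "(cyl_mean n (\<lambda>\<eta>. sgnb (f \<eta>)) w)\<^sup>2 = 1"
      by (simp add: cyl_mean_one sgnb_def)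
    moreover have "cyl_mean n (indicator {w. maxW f w \<le> n}) w \<le> cyl_mean n (\<lambda>_. 1) w"
      by (rule cyl_mean_mono) (auto simp: indicator_def intro!: Cube.integrable_const_bound[where B=1])
    ultimately show ?thesis by (simp add: cyl_mean_one)
  next
    case False
    have "AE \<eta> in Cube. indicator {w. maxW f w \<le> n} \<eta> * indicator (cylinder n w) \<eta> = (0::real)"
      using AE_decided_maxW[OF \<open>finitary f\<close>]
    proof eventually_elim
      case (elim \<eta>)
      have False if "maxW f \<eta> \<le> n" "\<eta> \<in> cylinder n w"
        using decided_mono[OF elim that(1)] decided_cong[OF that(2)] False by blast
      then show ?case by (auto simp: indicator_def)
    qed
    then have "cyl_mean n (indicator {w. maxW f w \<le> n}) w = 0"
      by (simp add: cyl_mean_def integral_eq_zero_AE)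
    then show ?thesis by simp
  qed
qed

lemma Var_bf_eq:
  assumes f: "boolean_function f"
  shows "Var_bf f = 1 - (\<integral>w. sgnb (f w) \<partial>Cube)\<^sup>2"
proof -
  have [measurable]: "f \<in> measurable Cube (count_space UNIV)"
    using f by (simp add: boolean_function_def)
  have [simp]: "(sgnb b)\<^sup>2 = 1" for b by (simp add: sgnb_def)
  have "Var_bf f = Cube.variance (\<lambda>w. sgnb (f w))" by (simp add: Var_bf_def)
  also have "\<dots> = (\<integral>w. (sgnb (f w))\<^sup>2 \<partial>Cube) - (\<integral>w. sgnb (f w) \<partial>Cube)\<^sup>2"
    by (rule Cube.variance_eq) (auto intro!: Cube.integrable_const_bound[where B=1] simp: sgnb_def)
  finally show ?thesis using Cube.prob_space by simp
qed

text \<open>The finite inequality is applied to \<open>g\<close>, the average of the sign over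
  cylinders of length \<open>n\<close>. Truncation lowers the variance by at most the probability
  that \<open>maxW\<close> exceeds \<open>n\<close>, an explicit error that later tends to
  0.\<close>

lemma finitary_influence_inequality:
  assumes f: "boolean_function f" and "finitary f" and "0 \<le> L + 1"
  shows "(L + 1) * (Var_bf f - Cube.prob {w. n < maxW f w})
    \<le> 4 * (\<Sum>k<n. influence f k) + exp L * (\<Sum>k<n. (influence f k)\<^sup>2)"
proof -
  note [measurable] = measurable_maxW[OF f]
  have [measurable]: "f \<in> measurable Cube (count_space UNIV)"
    using f by (simp add: boolean_function_def)
  have "{w \<in> space Cube. maxW f w \<le> n} \<in> sets Cube" by measurable
  then have A[measurable]: "{w. maxW f w \<le> n} \<in> sets Cube" by simp
  define F where "F = (\<lambda>\<eta>. sgnb (f \<eta>))"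
  define g where "g = cyl_mean n F"
  have F: "integrable Cube F"
    by (auto intro!: Cube.integrable_const_bound[where B=1] simp: sgnb_def F_def)
  have g1: "\<bar>g w\<bar> \<le> 1" for w
  proof -
    have "\<bar>g w\<bar> \<le> cyl_mean n (\<lambda>\<eta>. \<bar>F \<eta>\<bar>) w" unfolding g_def by (rule abs_cyl_mean_le)
    also have "(\<lambda>\<eta>. \<bar>F \<eta>\<bar>) = (\<lambda>_. 1)" by (auto simp: F_def sgnb_def)
    finally show ?thesis by (simp add: cyl_mean_one)
  qed
  \<comment> \<open>The finite averages carry a base point, which the claim does not mention; an
    arbitrary one serves.\<close>
  fix w :: "nat \<Rightarrow> bool"
  have abs_diff: "cube_mean n (\<lambda>w. \<bar>coord_diff k g w\<bar>) w \<le> influence f k" if "k < n" for k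
  proof -
    have "cube_mean n (\<lambda>w. \<bar>coord_diff k g w\<bar>) w
        \<le> cube_mean n (cyl_mean n (\<lambda>\<eta>. \<bar>F \<eta> - F (flip_bit k \<eta>)\<bar> / 2)) w"
      unfolding g_def by (intro cube_mean_mono abs_coord_diff_cyl_mean_le F that)
    also have "\<dots> = (\<integral>\<eta>. \<bar>F \<eta> - F (flip_bit k \<eta>)\<bar> / 2 \<partial>Cube)"
      using F integrable_flip_bit[OF F] by (intro cube_mean_cyl_mean) auto
    finally show ?thesis by (simp add: influence_eq_integral F_def)
  qed
  have sq_diff: "cube_mean n (\<lambda>w. (coord_diff k g w)\<^sup>2) w \<le> influence f k" if "k < n" for k
  proof -
    have "(coord_diff k g w)\<^sup>2 \<le> \<bar>coord_diff k g w\<bar>" for w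
    proof -
      have "\<bar>coord_diff k g w\<bar> \<le> 1"
        using g1[of "w(k := True)"] g1[of "w(k := False)"] by (simp add: coord_diff_def)
      then have "\<bar>coord_diff k g w\<bar> * \<bar>coord_diff k g w\<bar> \<le> \<bar>coord_diff k g w\<bar> * 1"
        by (intro mult_left_mono) auto
      then show ?thesis by (simp add: power2_eq_square)
    qed
    then show ?thesis by (rule order_trans[OF cube_mean_mono abs_diff[OF that]])
  qed
  have "Cube.prob {w. maxW f w \<le> n} = cube_mean n (cyl_mean n (indicator {w. maxW f w \<le> n})) w"
    by (subst cube_mean_cyl_mean) (auto intro: integrable_Cube_indicator)
  also have "\<dots> \<le> cube_mean n (\<lambda>w. (g w)\<^sup>2) w"
    unfolding g_def F_def by (intro cube_mean_mono cyl_mean_sgnb_sq_ge f \<open>finitary f\<close>)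
  finally have sq_ge: "Cube.prob {w. maxW f w \<le> n} \<le> cube_mean n (\<lambda>w. (g w)\<^sup>2) w" .
  have "{w. n < maxW f w} = space Cube - {w. maxW f w \<le> n}" by auto
  then have "Cube.prob {w. n < maxW f w} = 1 - Cube.prob {w. maxW f w \<le> n}"
    using Cube.prob_compl[OF A] by simp
  moreover have "cube_mean n g w = (\<integral>\<eta>. sgnb (f \<eta>) \<partial>Cube)"
    using cube_mean_cyl_mean[OF F, of n w] by (simp add: g_def F_def)
  ultimately have "Var_bf f - Cube.prob {w. n < maxW f w}
      \<le> cube_mean n (\<lambda>w. (g w)\<^sup>2) w - (cube_mean n g w)\<^sup>2"
    using sq_ge by (simp add: Var_bf_eq[OF f])
  then have "(L + 1) * (Var_bf f - Cube.prob {w. n < maxW f w})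
      \<le> (L + 1) * (cube_mean n (\<lambda>w. (g w)\<^sup>2) w - (cube_mean n g w)\<^sup>2)"
    using \<open>0 \<le> L + 1\<close> by (rule mult_left_mono)
  also have "\<dots> \<le> 4 * (\<Sum>k<n. cube_mean n (\<lambda>w. (coord_diff k g w)\<^sup>2) w)
      + exp L * (\<Sum>k<n. (cube_mean n (\<lambda>w. \<bar>coord_diff k g w\<bar>) w)\<^sup>2)"
    by (rule cube_falik_samorodnitsky)
  also have "\<dots> \<le> 4 * (\<Sum>k<n. influence f k) + exp L * (\<Sum>k<n. (influence f k)\<^sup>2)"
    by (intro add_mono mult_left_mono sum_mono power_mono sq_diff abs_diff cube_mean_nonneg) auto
  finally show ?thesis .
qed

section \<open>Moment bound for the total influence\<close>

lemma powr_ge_linear: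
  fixes x p :: real
  assumes "1 \<le> x" "1 < p"
  shows "(p - 1) * (x - 1) \<le> x powr p"
proof -
  have "ln (1 / x) \<le> 1 / x - 1" using assms by (intro ln_le_minus_one) simp
  then have "x - 1 \<le> x * ln x" using assms by (simp add: ln_div field_simps)
  then have "(p - 1) * (x - 1) \<le> (p - 1) * (x * ln x)" using assms by (intro mult_left_mono) auto
  also have "\<dots> \<le> x * (1 + (p - 1) * ln x)" using assms by (simp add: algebra_simps)
  also have "\<dots> \<le> x * exp ((p - 1) * ln x)"
    using assms by (intro mult_left_mono exp_ge_add_one_self) auto
  also have "\<dots> = x powr 1 * x powr (p - 1)" using assms by (simp add: powr_def)
  also have "\<dots> = x powr p" unfolding powr_add[symmetric] by simp
  finally show ?thesis .
qed

lemma sum_influence_le: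
  fixes p \<delta> \<nu> :: real
  assumes f: "boolean_function f" and "finitary f" and p: "1 < p"
    and Mp: "integrable Cube (\<lambda>w. real (maxW f w) powr p)"
    and \<delta>: "\<And>k. influence f k \<le> \<delta>" and \<nu>: "1 \<le> \<nu>"
  shows "(\<Sum>k<n. influence f k)
    \<le> 2 * \<nu> * \<delta> + \<nu> * (1 / (p - 1) * (\<integral>w. real (maxW f w) powr p \<partial>Cube) / \<nu> powr p)"
proof -
  note [measurable] = measurable_maxW[OF f]
  have A[measurable]: "{w. k < maxW f w} \<in> sets Cube" for k
  proof -
    have "{w \<in> space Cube. k < maxW f w} \<in> sets Cube" by measurable
    then show ?thesis by simp
  qed
  \<comment> \<open>Coordinates below \<open>K\<close> are charged \<open>\<delta>\<close> each, and
    \<open>1 \<le> \<nu>\<close> gives \<open>K \<le> 2 * \<nu>\<close>. The others are charged to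
    the tail of \<open>maxW\<close>, whose sum counts the excess of \<open>maxW\<close> over
    \<open>K\<close>.\<close>
  define K where "K = nat \<lceil>\<nu>\<rceil>"
  have K: "\<nu> \<le> real K" "real K \<le> 2 * \<nu>" using \<nu> by (simp_all add: K_def) linarith+
  have \<delta>0: "0 \<le> \<delta>" using \<delta>[of 0] by (rule order_trans[rotated]) (simp add: influence_def)
  have tail: "(\<Sum>k\<in>{K..<n}. indicator {w. k < maxW f w} w)
      \<le> \<nu> / ((p - 1) * \<nu> powr p) * real (maxW f w) powr p" for w
  proof -
    have "(\<Sum>k\<in>{K..<n}. indicator {w. k < maxW f w} w :: real) = real (card ({K..<n} \<inter> {k. k < maxW f w}))"
      by (simp add: indicator_def sum.If_cases)
    also have "\<dots> \<le> real (card {K..<maxW f w})"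
      by (intro of_nat_mono card_mono) auto
    also have "\<dots> \<le> \<nu> / ((p - 1) * \<nu> powr p) * real (maxW f w) powr p"
    proof (cases "K < maxW f w")
      case True
      define x where "x = real (maxW f w) / \<nu>"
      have "1 \<le> x" using True K \<nu> by (simp add: x_def)
      have "real (card {K..<maxW f w}) \<le> \<nu> * (x - 1)"
        using True K \<nu> by (simp add: x_def right_diff_distrib of_nat_diff)
      also have "\<dots> \<le> \<nu> * (x powr p / (p - 1))"
        using powr_ge_linear[OF \<open>1 \<le> x\<close> p] p \<nu>
        by (intro mult_left_mono) (simp_all add: field_simps)
      also have "\<dots> = \<nu> / ((p - 1) * \<nu> powr p) * real (maxW f w) powr p"
        using \<nu> by (simp add: x_def powr_divide)
      finally show ?thesis .
    qed (use \<nu> p in simp)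
    finally show ?thesis .
  qed
  have "(\<Sum>k<n. influence f k) \<le> (\<Sum>k<K. influence f k) + (\<Sum>k\<in>{K..<n}. influence f k)"
    by (subst sum.union_disjoint[symmetric]) (auto intro!: sum_mono2 simp: influence_def)
  also have "(\<Sum>k<K. influence f k) \<le> 2 * \<nu> * \<delta>"
  proof -
    have "(\<Sum>k<K. influence f k) \<le> real K * \<delta>"
      using sum_bounded_above[of "{..<K}" "influence f" \<delta>] \<delta> by simp
    also have "\<dots> \<le> 2 * \<nu> * \<delta>" using K \<delta>0 by (intro mult_right_mono) auto
    finally show ?thesis .
  qed
  also have "(\<Sum>k\<in>{K..<n}. influence f k) \<le> (\<Sum>k\<in>{K..<n}. Cube.prob {w. k < maxW f w})"
    by (intro sum_mono influence_le_prob_maxW f \<open>finitary f\<close>)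
  also have "\<dots> = (\<integral>w. (\<Sum>k\<in>{K..<n}. indicator {w. k < maxW f w} w) \<partial>Cube)"
    by (subst Bochner_Integration.integral_sum) (auto intro: integrable_Cube_indicator)
  also have "\<dots> \<le> (\<integral>w. \<nu> / ((p - 1) * \<nu> powr p) * real (maxW f w) powr p \<partial>Cube)"
    by (intro integral_mono tail Bochner_Integration.integrable_sum integrable_mult_right Mp integrable_Cube_indicator) auto
  also have "\<dots> = \<nu> * (1 / (p - 1) * (\<integral>w. real (maxW f w) powr p \<partial>Cube) / \<nu> powr p)"
    by simp
  finally show ?thesis by simp
qed

theorem mainTheorem17:
  shows "\<exists>c > 0. \<forall>p > (1::real). \<forall>f.
     boolean_function f \<and> nonconstant f \<and> knowable p f \<longrightarrow>
     (let \<nu> = (\<integral>\<omega>. real (maxW f \<omega>) \<partial>Cube) in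
       (SUP k. influence f k) \<ge>
         c * Var_bf f * ln \<nu> / \<nu>
         - 1 / (p - 1) * (\<integral>\<omega>. real (maxW f \<omega>) powr p \<partial>Cube) / \<nu> powr p)"
proof (rule exI[of _ "1/40"], intro conjI allI impI)
  fix p :: real and f
  assume p: "1 < p" and asm: "boolean_function f \<and> nonconstant f \<and> knowable p f"
  then have f: "boolean_function f" and fin: "finitary f"
    and nn: "(\<integral>\<^sup>+ w. ennreal (real (maxW f w) powr p) \<partial>Cube) < \<infinity>"
    by (auto simp: knowable_def)
  note [measurable] = measurable_maxW[OF f]
  define M where "M = (\<lambda>w. real (maxW f w))"
  have [measurable]: "M \<in> borel_measurable Cube" unfolding M_def by measurable
  have Mp: "integrable Cube (\<lambda>w. M w powr p)"
    using nn by (intro integrableI_bounded) (simp_all add: M_def)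
  have M: "integrable Cube M"
  proof (rule Bochner_Integration.integrable_bound[OF Mp])
    show "AE w in Cube. norm (M w) \<le> norm (M w powr p)"
    proof (rule AE_I2)
      fix w
      show "norm (M w) \<le> norm (M w powr p)"
      \<comment> \<open>\<open>M\<close> takes natural values: at 0 both sides vanish, and from 1 on
        powers increase with the exponent.\<close>
      proof (cases "maxW f w = 0")
        case False
        then have "1 \<le> M w" by (simp add: M_def)
        then show ?thesis using powr_mono[of 1 p "M w"] p by simp
      qed (simp add: M_def)
    qed
  qed simp
  define \<nu> where "\<nu> = (\<integral>w. M w \<partial>Cube)"
  define X where "X = 1 / (p - 1) * (\<integral>w. M w powr p \<partial>Cube) / \<nu> powr p"
  define \<delta> where "\<delta> = (SUP k. influence f k)"
  define V where "V = Var_bf f"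
  have inf01: "0 \<le> influence f k" "influence f k \<le> 1" for k
    by (simp_all add: influence_def)
  have \<delta>: "influence f k \<le> \<delta>" for k
    unfolding \<delta>_def by (rule cSUP_upper) (auto intro!: bdd_aboveI[of _ 1] inf01)
  have \<delta>0: "0 \<le> \<delta>" using \<delta>[of 0] inf01(1)[of 0] by linarith
  have X0: "0 \<le> X" using p by (auto simp: X_def intro!: integral_nonneg)
  have \<nu>0: "0 \<le> \<nu>" by (auto simp: \<nu>_def M_def intro!: integral_nonneg)
  have V: "0 \<le> V" "V \<le> 1" by (simp add: V_def Var_bf_def) (simp add: V_def Var_bf_eq[OF f])
  have "1/40 * V * ln \<nu> / \<nu> - X \<le> \<delta>"
  proof (cases "\<nu> \<le> 1")
    case True
    \<comment> \<open>The subcase \<open>\<nu> = 0\<close> rests on the convention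
      \<open>ln 0 = 0\<close>.\<close>
    then have "ln \<nu> \<le> 0" using \<nu>0 by (cases "\<nu> = 0") auto
    then have "1/40 * V * ln \<nu> / \<nu> \<le> 0"
      using V \<nu>0 by (intro divide_nonpos_nonneg mult_nonneg_nonpos) auto
    then show ?thesis using X0 \<delta>0 by linarith
  next
    case False
    then have \<nu>: "1 < \<nu>" by simp
    then have ln: "0 < ln \<nu>" by simp
    show ?thesis
    proof (cases "\<delta> \<le> 1 / sqrt \<nu>")
      case False
      have "ln \<nu> \<le> 2 * sqrt \<nu>"
        using ln_le_minus_one[of "sqrt \<nu>"] \<nu> by (simp add: ln_sqrt)
      then have "V * ln \<nu> \<le> 1 * (2 * sqrt \<nu>)"
        using V ln by (intro mult_mono) auto
      moreover have "0 \<le> sqrt \<nu>" using \<nu> by simp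
      ultimately have "1/40 * V * ln \<nu> \<le> sqrt \<nu>" by linarith
      then have "1/40 * V * ln \<nu> / \<nu> \<le> sqrt \<nu> / \<nu>"
        using \<nu> by (intro divide_right_mono) auto
      also have "\<dots> = 1 / sqrt \<nu>" using \<nu> by (simp add: field_simps)
      finally show ?thesis using False X0 by linarith
    next
      case True
      \<comment> \<open>Any \<open>L\<close> between 0 and \<open>ln \<nu> / 2\<close> would make
        \<open>exp L / sqrt \<nu>\<close> at most 1; this lets the quadratic term be absorbed into
        the linear one, turning the factor 4 into 5.\<close>
      define L where "L = ln \<nu> / 4"
      define B where "B = 2 * \<nu> * \<delta> + \<nu> * X"
      have sumB: "(\<Sum>k<n. influence f k) \<le> B" for n
        unfolding B_def X_def M_def
        by (rule sum_influence_le[OF f fin p _ \<delta>]) (use Mp \<nu> in \<open>simp_all add: M_def\<close>)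
      have expL: "exp L * (1 / sqrt \<nu>) \<le> 1"
      proof -
        have "exp L \<le> exp (ln \<nu> / 2)" using ln by (simp add: L_def)
        also have "\<dots> = sqrt \<nu>" using \<nu> by (simp add: ln_sqrt[symmetric])
        finally show ?thesis using \<nu> by (simp add: field_simps)
      qed
      have main: "(L + 1) * (V - \<nu> / real n) \<le> 5 * B" if "0 < n" for n
      proof -
        \<comment> \<open>Markov's inequality.\<close>
        have "Cube.prob {w. n < maxW f w} \<le> \<nu> / real n"
        proof -
          have "Cube.prob {w. n < maxW f w} = (\<integral>w. indicator {w \<in> space Cube. n < maxW f w} w \<partial>Cube)"
            by simp
          also have "\<dots> \<le> (\<integral>w. M w / real n \<partial>Cube)"
          proof (rule integral_mono)
            show "integrable Cube (indicator {w \<in> space Cube. n < maxW f w} :: _ \<Rightarrow> real)"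
              by (rule integrable_Cube_indicator) measurable
          qed (use M \<open>0 < n\<close> in \<open>auto simp: M_def indicator_def\<close>)
          finally show ?thesis by (simp add: \<nu>_def)
        qed
        then have "(L + 1) * (V - \<nu> / real n) \<le> (L + 1) * (V - Cube.prob {w. n < maxW f w})"
          using ln by (intro mult_left_mono) (auto simp: L_def)
        also have "\<dots> \<le> 4 * (\<Sum>k<n. influence f k) + exp L * (\<Sum>k<n. (influence f k)\<^sup>2)"
          unfolding V_def using ln by (intro finitary_influence_inequality f fin) (simp add: L_def)
        also have "(\<Sum>k<n. (influence f k)\<^sup>2) \<le> (\<Sum>k<n. (1 / sqrt \<nu>) * influence f k)"
          unfolding power2_eq_square using True \<delta> inf01
          by (intro sum_mono mult_right_mono) (auto intro: order_trans)
        also have "4 * (\<Sum>k<n. influence f k) + exp L * (\<Sum>k<n. (1 / sqrt \<nu>) * influence f k)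
            = (4 + exp L * (1 / sqrt \<nu>)) * (\<Sum>k<n. influence f k)"
          by (simp add: sum_distrib_left[symmetric] sum_divide_distrib[symmetric] algebra_simps)
        also have "\<dots> \<le> 5 * (\<Sum>k<n. influence f k)"
          using expL inf01 by (intro mult_right_mono sum_nonneg) auto
        also have "\<dots> \<le> 5 * B" using sumB by simp
        finally show ?thesis by simp
      qed
      \<comment> \<open>Since \<open>B\<close> does not depend on \<open>n\<close>, the truncation
        error vanishes in the limit; \<open>V - 0\<close> is the form in which the limit rules
        deliver the result.\<close>
      have "(L + 1) * (V - 0) \<le> 5 * B"
      proof (rule LIMSEQ_le_const2)
        show "(\<lambda>n. (L + 1) * (V - \<nu> / real n)) \<longlonglongrightarrow> (L + 1) * (V - 0)"
          by (intro tendsto_intros lim_const_over_n)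
        show "\<exists>N. \<forall>n\<ge>N. (L + 1) * (V - \<nu> / real n) \<le> 5 * B"
          using main by (intro exI[of _ 1]) auto
      qed
      then have "V * ln \<nu> / 4 \<le> 5 * B" using V by (simp add: L_def algebra_simps)
      \<comment> \<open>The constant 40 is the product of 4 from \<open>L\<close>, 5 from the
        absorbed quadratic term and 2 from \<open>K \<le> 2 * \<nu>\<close>.\<close>
      then have "V * ln \<nu> / 40 \<le> \<nu> * (\<delta> + X / 2)" by (simp add: B_def algebra_simps)
      then have "1/40 * V * ln \<nu> / \<nu> \<le> \<delta> + X / 2" using \<nu> by (simp add: field_simps)
      then show ?thesis using X0 by linarith
    qed
  qed
  then show "(let \<nu> = (\<integral>\<omega>. real (maxW f \<omega>) \<partial>Cube) in
       (SUP k. influence f k) \<ge>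
         1/40 * Var_bf f * ln \<nu> / \<nu>
         - 1 / (p - 1) * (\<integral>\<omega>. real (maxW f \<omega>) powr p \<partial>Cube) / \<nu> powr p)"
    by (simp add: Let_def \<delta>_def V_def X_def \<nu>_def M_def)
qed simp

end
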